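(* If $X$ is a generalized metric space then its Isbell completion $I(X)$ is cocomplete and hence can be given a co-metric semi-tropical module structure.
   Context: A generalized metric space is a set $X$ with $d_X\colon X\times X\to[0,\infty]$ such that $d_X(x,x)=0$ and $d_X(x,y)+d_X(y,z)\ge d_X(x,z)$ for all $x,y,z\in X$ (no symmetry, separation or finiteness). For $a,b\in[0,\infty]$ write $b\dot{-}a:=\max(b-a,0)$ (with $\infty\dot{-}\infty=0$); $[0,\infty]$ is a generalized metric space with $d(a,b)=b\dot{-}a$. $X^{\mathrm{op}}$ has the same points and reversed metric. A short map $F\colon X\to Y$ is a function with $d_X(x,x')\ge d_Y(F(x),F(x'))$. $\widehat X$ is the space of presheaves, i.e. short maps $f\colon X^{\mathrm{op}}\to[0,\infty]$, with metric $d_{\widehat X}(f,f')=\sup_x(f'(x)\dot{-}f(x))$; $\check X$ is the space of co-presheaves, i.e. short maps $g\colon X\to[0,\infty]$, with metric $\sup_x(g'(x)\dot{-}g(x))$. Define $L(f)(y)=\sup_{x}(d_X(x,y)\dot{-}f(x))$ for $f\in\widehat X$ and $R(g)(x)=\sup_y(d_X(x,y)\dot{-}g(y))$ for $g\in\check X^{\mathrm{op}}$. The Isbell completion is $I(X)=\{(f,g)\in\widehat X\times\check X^{\mathrm{op}}\mid L(f)=g,\ R(g)=f\}$ with metric $d_{I(X)}((f,g),(f',g'))=\max\{d_{\widehat X}(f,f'),\,d_{\check X^{\mathrm{op}}}(g,g')\}$. For a generalized metric space $Z$, a short map $J\colon D\to Z$ from a generalized metric space $D$, and a short map $W\colon D^{\mathrm{op}}\to[0,\infty]$,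 a colimit of $J$ weighted by $W$ is a point $c\in Z$ with $d_Z(c,z)=\sup_{e\in D}(d_Z(J(e),z)\dot{-}W(e))$ for all $z\in Z$. $Z$ is cocomplete if such colimits exist for all $D,J,W$. The semi-tropical semiring is $([0,\infty],\min,+)$ (additive unit $\infty$, multiplicative unit $0$). A semi-tropical module is a commutative monoid $(M,\oplus,\mathbf 0)$ with an action $\odot\colon[0,\infty]\times M\to M$ such that $r\mapsto r\odot(-)$ is a unital semiring morphism to the semiring $(\operatorname{End}(M),\oplus,\circ)$ of monoid endomorphisms of $M$ (preserving addition, multiplication and both units). Morphisms are monoid maps preserving the action. $([0,\infty],\max)$ is a semi-tropical module via $r\odot m:=m\dot{-}r$. A co-metric semi-tropical module structure on a generalized metric space $(M,d)$ is a semi-tropical module structure on $M$ such that for every $x\in M$ the map $d(-,x)\colon M\to([0,\infty],\max)$ is a morphism of semi-tropical modules. *)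

theory Defs
  imports "HOL-Library.Extended_Nonnegative_Real" "HOL-Library.FuncSet" "HOL-Algebra.Ring"
begin

text \<open>The library subtraction on \<^typ>\<open>ennreal\<close> satisfies \<open>\<infinity> - \<infinity> = \<infinity>\<close>;
  the truncated difference used here must satisfy \<open>\<infinity> -\<^sub>+ \<infinity> = 0\<close>.\<close>

definition monus :: "ennreal \<Rightarrow> ennreal \<Rightarrow> ennreal"  (infixl "-\<^sub>+" 65) where
  "b -\<^sub>+ a = (if b \<le> a then 0 else b - a)"

definition ennreal_gdist :: "ennreal \<Rightarrow> ennreal \<Rightarrow> ennreal" where
  "ennreal_gdist a b = b -\<^sub>+ a"

locale generalized_metric_space =
  fixes X :: "'a set" and d :: "'a \<Rightarrow> 'a \<Rightarrow> ennreal"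
  assumes dist_self: "x \<in> X \<Longrightarrow> d x x = 0"
    and triangle: "\<lbrakk>x \<in> X; y \<in> X; z \<in> X\<rbrakk> \<Longrightarrow> d x y + d y z \<ge> d x z"

definition op_dist :: "('a \<Rightarrow> 'a \<Rightarrow> ennreal) \<Rightarrow> 'a \<Rightarrow> 'a \<Rightarrow> ennreal" where
  "op_dist d x y = d y x"

definition short_map ::
  "'a set \<Rightarrow> ('a \<Rightarrow> 'a \<Rightarrow> ennreal) \<Rightarrow> 'b set \<Rightarrow> ('b \<Rightarrow> 'b \<Rightarrow> ennreal) \<Rightarrow> ('a \<Rightarrow> 'b) \<Rightarrow> bool" where
  "short_map X dX Y dY F \<longleftrightarrow>
     F \<in> X \<rightarrow> Y \<and> (\<forall>x\<in>X. \<forall>x'\<in>X. dX x x' \<ge> dY (F x) (F x'))"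

text \<open>Functions on \<open>X\<close> are represented by functions that are extensional on \<open>X\<close>, so that
  equality of (co-)presheaves is equality on \<open>X\<close>.\<close>

definition presheaves :: "'a set \<Rightarrow> ('a \<Rightarrow> 'a \<Rightarrow> ennreal) \<Rightarrow> ('a \<Rightarrow> ennreal) set" where
  "presheaves X d = {f \<in> extensional X. short_map X (op_dist d) UNIV ennreal_gdist f}"

definition copresheaves :: "'a set \<Rightarrow> ('a \<Rightarrow> 'a \<Rightarrow> ennreal) \<Rightarrow> ('a \<Rightarrow> ennreal) set" where
  "copresheaves X d = {g \<in> extensional X. short_map X d UNIV ennreal_gdist g}"

text \<open>The metric of both the presheaf and the co-presheaf space. Suprema are taken in
  \<^typ>\<open>ennreal\<close>, where the supremum of the empty set is \<open>0\<close>.\<close>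

definition sup_dist :: "'a set \<Rightarrow> ('a \<Rightarrow> ennreal) \<Rightarrow> ('a \<Rightarrow> ennreal) \<Rightarrow> ennreal" where
  "sup_dist X f f' = (SUP x\<in>X. f' x -\<^sub>+ f x)"

definition isbell_L ::
  "'a set \<Rightarrow> ('a \<Rightarrow> 'a \<Rightarrow> ennreal) \<Rightarrow> ('a \<Rightarrow> ennreal) \<Rightarrow> 'a \<Rightarrow> ennreal" where
  "isbell_L X d f = (\<lambda>y\<in>X. SUP x\<in>X. d x y -\<^sub>+ f x)"

definition isbell_R ::
  "'a set \<Rightarrow> ('a \<Rightarrow> 'a \<Rightarrow> ennreal) \<Rightarrow> ('a \<Rightarrow> ennreal) \<Rightarrow> 'a \<Rightarrow> ennreal" where
  "isbell_R X d g = (\<lambda>x\<in>X. SUP y\<in>X. d x y -\<^sub>+ g y)"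

definition isbell_completion ::
  "'a set \<Rightarrow> ('a \<Rightarrow> 'a \<Rightarrow> ennreal) \<Rightarrow> (('a \<Rightarrow> ennreal) \<times> ('a \<Rightarrow> ennreal)) set" where
  "isbell_completion X d =
     {(f, g) \<in> presheaves X d \<times> copresheaves X d. isbell_L X d f = g \<and> isbell_R X d g = f}"

definition isbell_dist ::
  "'a set \<Rightarrow> ('a \<Rightarrow> ennreal) \<times> ('a \<Rightarrow> ennreal) \<Rightarrow> ('a \<Rightarrow> ennreal) \<times> ('a \<Rightarrow> ennreal) \<Rightarrow> ennreal" where
  "isbell_dist X p q =
     max (sup_dist X (fst p) (fst q)) (op_dist (sup_dist X) (snd p) (snd q))"

definition is_weighted_colimit ::
  "'d set \<Rightarrow> 'z set \<Rightarrow> ('z \<Rightarrow> 'z \<Rightarrow> ennreal) \<Rightarrow> ('d \<Rightarrow> 'z) \<Rightarrow> ('d \<Rightarrow> ennreal) \<Rightarrow> 'z \<Rightarrow> bool" where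
  "is_weighted_colimit D Z dZ J W c \<longleftrightarrow>
     c \<in> Z \<and> (\<forall>z\<in>Z. dZ c z = (SUP e\<in>D. dZ (J e) z -\<^sub>+ W e))"

text \<open>A HOL formula cannot quantify over types, so the type of the points of the indexing
  spaces \<open>D\<close> is a parameter. Cocompleteness proper is \<open>cocomplete TYPE('d) Z dZ\<close> with
  \<open>'d\<close> a free type variable of the theorem, which is then universally quantified.\<close>

definition cocomplete :: "'d itself \<Rightarrow> 'z set \<Rightarrow> ('z \<Rightarrow> 'z \<Rightarrow> ennreal) \<Rightarrow> bool" where
  "cocomplete _ Z dZ \<longleftrightarrow>
     generalized_metric_space Z dZ \<and>
     (\<forall>(D :: 'd set) dD J W.
        generalized_metric_space D dD \<longrightarrow>
        short_map D dD Z dZ J \<longrightarrow>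
        short_map D (op_dist dD) UNIV ennreal_gdist W \<longrightarrow>
        (\<exists>c. is_weighted_colimit D Z dZ J W c))"

definition semitropical :: "ennreal ring" where
  "semitropical = \<lparr>carrier = UNIV, mult = (+), one = 0, zero = \<infinity>, add = min\<rparr>"

text \<open>Commutative monoids \<open>(M, \<oplus>, \<zero>)\<close> are represented by the multiplicative monoid records
  of the library, so that \<open>\<oplus>\<close> and \<open>\<zero>\<close> become \<open>\<otimes>\<^bsub>M\<^esub>\<close> and \<open>\<one>\<^bsub>M\<^esub>\<close>. The library's
  \<^const>\<open>hom\<close> does not require preservation of the unit.\<close>

definition monoid_maps :: "('a, 'm) monoid_scheme \<Rightarrow> ('b, 'n) monoid_scheme \<Rightarrow> ('a \<Rightarrow> 'b) set" where
  "monoid_maps M N = {\<phi> \<in> hom M N. \<phi> \<one>\<^bsub>M\<^esub> = \<one>\<^bsub>N\<^esub>}"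

definition End_semiring :: "('a, 'm) monoid_scheme \<Rightarrow> ('a \<Rightarrow> 'a) ring" where
  "End_semiring M =
     \<lparr>carrier = monoid_maps M M \<inter> extensional (carrier M),
      mult = compose (carrier M),
      one = (\<lambda>m\<in>carrier M. m),
      zero = (\<lambda>m\<in>carrier M. \<one>\<^bsub>M\<^esub>),
      add = (\<lambda>\<phi> \<psi>. \<lambda>m\<in>carrier M. \<phi> m \<otimes>\<^bsub>M\<^esub> \<psi> m)\<rparr>"

text \<open>\<^const>\<open>ring_hom\<close> requires preservation of \<open>\<oplus>\<close>, \<open>\<otimes>\<close> and \<open>\<one>\<close> but not of \<open>\<zero>\<close>.\<close>

definition semiring_maps :: "('a, 'm) ring_scheme \<Rightarrow> ('b, 'n) ring_scheme \<Rightarrow> ('a \<Rightarrow> 'b) set" where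
  "semiring_maps R S = {h \<in> ring_hom R S. h \<zero>\<^bsub>R\<^esub> = \<zero>\<^bsub>S\<^esub>}"

locale semitropical_module = comm_monoid M
  for M :: "('a, 'm) monoid_scheme" (structure) +
  fixes act :: "ennreal \<Rightarrow> 'a \<Rightarrow> 'a"
  assumes act_semiring_map:
    "(\<lambda>r. restrict (act r) (carrier M)) \<in> semiring_maps semitropical (End_semiring M)"

definition semitropical_module_maps ::
  "('a, 'm) monoid_scheme \<Rightarrow> (ennreal \<Rightarrow> 'a \<Rightarrow> 'a) \<Rightarrow>
   ('b, 'n) monoid_scheme \<Rightarrow> (ennreal \<Rightarrow> 'b \<Rightarrow> 'b) \<Rightarrow> ('a \<Rightarrow> 'b) set" where
  "semitropical_module_maps M actM N actN =
     {\<phi> \<in> monoid_maps M N. \<forall>r. \<forall>m\<in>carrier M. \<phi> (actM r m) = actN r (\<phi> m)}"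

definition max_monoid :: "ennreal monoid" where
  "max_monoid = \<lparr>carrier = UNIV, mult = max, one = 0\<rparr>"

definition max_act :: "ennreal \<Rightarrow> ennreal \<Rightarrow> ennreal" where
  "max_act r m = m -\<^sub>+ r"

locale cometric_semitropical_module =
  generalized_metric_space "carrier M" d + semitropical_module M act
  for M :: "('a, 'm) monoid_scheme" (structure)
    and act :: "ennreal \<Rightarrow> 'a \<Rightarrow> 'a"
    and d :: "'a \<Rightarrow> 'a \<Rightarrow> ennreal" +
  assumes dist_module_map:
    "x \<in> carrier M \<Longrightarrow> (\<lambda>m. d m x) \<in> semitropical_module_maps M act max_monoid max_act"

lemma monus_le_iff: "b -\<^sub>+ a \<le> c \<longleftrightarrow> b \<le> a + c"
proof (cases "b \<le> a")
  case True
  then have "b \<le> a + c" using add_increasing2[of c b a] by simp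
  with True show ?thesis by (simp add: monus_def)
next
  case False
  then have "a \<noteq> \<infinity>" by auto
  with False show ?thesis
    by (auto simp: monus_def ennreal_minus_le_iff add.commute)
qed

lemma monus_triangle: "c -\<^sub>+ a \<le> (b -\<^sub>+ a) + (c -\<^sub>+ b)"
proof -
  have "b \<le> a + (b -\<^sub>+ a)" "c \<le> b + (c -\<^sub>+ b)"
    by (simp_all flip: monus_le_iff)
  then have "c \<le> a + (b -\<^sub>+ a) + (c -\<^sub>+ b)"
    by (meson add_right_mono order_trans)
  then show ?thesis by (simp add: monus_le_iff add.assoc)
qed

lemma generalized_metric_space_ennreal: "generalized_metric_space UNIV ennreal_gdist"
proof
  show "ennreal_gdist a a = 0" for a
    by (simp add: ennreal_gdist_def monus_def)
  show "ennreal_gdist a c \<le> ennreal_gdist a b + ennreal_gdist b c" for a b c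
    unfolding ennreal_gdist_def by (rule monus_triangle)
qed

lemma sup_dist_self: "sup_dist X f f = 0"
  by (cases "X = {}") (simp_all add: sup_dist_def monus_def bot_ennreal)

lemma sup_dist_triangle: "sup_dist X f h \<le> sup_dist X f g + sup_dist X g h"
  unfolding sup_dist_def
proof (rule SUP_least)
  fix x assume "x \<in> X"
  then show "h x -\<^sub>+ f x \<le> (SUP x\<in>X. g x -\<^sub>+ f x) + (SUP x\<in>X. h x -\<^sub>+ g x)"
    by (intro order_trans[OF monus_triangle[where b = "g x"] add_mono] SUP_upper)
qed

lemma generalized_metric_space_isbell:
  "generalized_metric_space (isbell_completion X d) (isbell_dist X)"
proof
  show "isbell_dist X p p = 0" for p
    by (simp add: isbell_dist_def op_dist_def sup_dist_self)
  show "isbell_dist X p r \<le> isbell_dist X p q + isbell_dist X q r" for p q r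
  proof -
    have "sup_dist X (fst p) (fst r) \<le> isbell_dist X p q + isbell_dist X q r"
      unfolding isbell_dist_def
      by (rule order_trans[OF sup_dist_triangle[of _ _ _ "fst q"]]) (intro add_mono max.cobounded1)
    moreover have "sup_dist X (snd r) (snd p) \<le> isbell_dist X q r + isbell_dist X p q"
      unfolding isbell_dist_def op_dist_def
      by (rule order_trans[OF sup_dist_triangle[of _ _ _ "snd q"]]) (intro add_mono max.cobounded2)
    ultimately show ?thesis
      unfolding isbell_dist_def[of X p r] op_dist_def by (simp add: add.commute)
  qed
qed

lemma ennreal_min_add: "min x y + z = min (x + z) (y + z)" for x y z :: ennreal
proof (cases "x \<le> y")
  case True
  then show ?thesis by (simp add: min_absorb1 add_right_mono)
next
  case False
  then have "y \<le> x" by simp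
  then show ?thesis by (simp add: min_absorb2 add_right_mono)
qed

lemma ennreal_add_min: "z + min x y = min (z + x) (z + y)" for x y z :: ennreal
  by (simp only: add.commute[of z] ennreal_min_add)

lemma semiring_semitropical: "semiring semitropical"
proof (rule semiring.intro)
  have "comm_monoid (add_monoid semitropical)"
    by (rule comm_monoidI) (auto simp: semitropical_def ac_simps)
  then show "abelian_monoid semitropical"
    by (rule abelian_monoid.intro)
  show "Group.monoid semitropical"
    by (rule monoidI) (auto simp: semitropical_def add.assoc)
  show "semiring_axioms semitropical"
    by (rule semiring_axioms.intro)
      (auto simp: semitropical_def ennreal_min_add ennreal_add_min)
qed

lemma semiring_End:
  assumes "comm_monoid M"
  shows "semiring (End_semiring M)"
proof -
  interpret comm_monoid M by fact
  have ext: "(\<phi> = \<psi>) \<longleftrightarrow> (\<forall>m\<in>carrier M. \<phi> m = \<psi> m)"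
    if "\<phi> \<in> extensional (carrier M)" "\<psi> \<in> extensional (carrier M)" for \<phi> \<psi> :: "'a \<Rightarrow> 'a"
    using that by (auto intro: extensionalityI)
  show ?thesis
  proof (rule semiring.intro)
    have "comm_monoid (add_monoid (End_semiring M))"
      by (rule comm_monoidI)
        (auto simp: End_semiring_def monoid_maps_def hom_def Pi_iff ext m_ac)
    then show "abelian_monoid (End_semiring M)"
      by (rule abelian_monoid.intro)
    show "Group.monoid (End_semiring M)"
      by (rule monoidI)
        (auto simp: End_semiring_def monoid_maps_def hom_def Pi_iff ext compose_def)
    show "semiring_axioms (End_semiring M)"
      by (rule semiring_axioms.intro)
        (auto simp: End_semiring_def monoid_maps_def hom_def Pi_iff ext compose_def)
  qed
qed

lemma semitropical_module_max: "semitropical_module max_monoid max_act"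
proof (intro semitropical_module.intro semitropical_module_axioms.intro)
  show "comm_monoid max_monoid"
    by (rule comm_monoidI) (auto simp: max_monoid_def ac_simps)
  have eqI: "x = y" if "\<And>c. x \<le> c \<longleftrightarrow> y \<le> c" for x y :: ennreal
    using that by (meson order_antisym order_refl)
  have "max a b -\<^sub>+ r = max (a -\<^sub>+ r) (b -\<^sub>+ r)" for a b r
    by (rule eqI) (simp add: monus_le_iff)
  moreover have "m -\<^sub>+ min r s = max (m -\<^sub>+ r) (m -\<^sub>+ s)" for m r s
    by (rule eqI) (simp add: monus_le_iff ennreal_min_add)
  moreover have "m -\<^sub>+ (r + s) = (m -\<^sub>+ s) -\<^sub>+ r" for m r s
    by (rule eqI) (simp add: monus_le_iff ac_simps)
  moreover have "0 -\<^sub>+ r = 0" "m -\<^sub>+ 0 = m" "m -\<^sub>+ \<infinity> = 0" for m r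
    by (simp_all add: monus_def)
  ultimately show "(\<lambda>r. restrict (max_act r) (carrier max_monoid))
      \<in> semiring_maps semitropical (End_semiring max_monoid)"
    by (simp add: max_monoid_def max_act_def semiring_maps_def ring_hom_def semitropical_def
        End_semiring_def monoid_maps_def hom_def compose_def fun_eq_iff)
qed

end

theory Submission
  imports Defs
begin

text \<open>For arbitrary functions \<open>f\<close>, \<open>g\<close> on \<open>X\<close> and \<open>r \<in> [0, \<infinity>]\<close>, each of \<open>L f \<le> g + r\<close> and
  \<open>R g \<le> f + r\<close> says that \<open>d x y \<le> f x + g y + r\<close> for all \<open>x\<close>, \<open>y\<close>. This adjunction makes the
  two components of the metric of the Isbell completion agree
  (\<open>isbell_dist_le_iff_snd\<close>), so that \<open>d(p, z) \<le> r\<close> just says that the co-presheaf of \<open>p\<close> is at most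
  \<open>r\<close> plus that of \<open>z\<close>. A colimit of points \<open>p\<^sub>e = (f\<^sub>e, g\<^sub>e)\<close> with weights \<open>w\<^sub>e\<close> therefore
  has to have the co-presheaf \<open>sup\<^sub>e (g\<^sub>e -\<^sub>+ w\<^sub>e)\<close>. Since \<open>g\<^sub>e = L f\<^sub>e\<close> and \<open>L\<close> turns infima
  into suprema, this is \<open>L h\<close> for \<open>h = inf\<^sub>e (f\<^sub>e + w\<^sub>e)\<close>, and \<open>L h\<close> is the second component of
  the point \<open>(R (L h), L h)\<close> because \<open>L R L = L\<close> (\<open>isbell_weighted_colimit\<close>).

  The Isbell completion is moreover separated, so a point \<open>p\<close> is determined by the function
  \<open>z \<mapsto> d(p, z)\<close>. Taking the empty colimit, binary coproducts and colimits of single points as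
  zero, addition and action, the assignment \<open>p \<mapsto> d(p, -)\<close> becomes an injection into functions
  with values in \<open>([0, \<infinity>], max)\<close> that takes these operations to the pointwise ones. The module laws
  are inherited along it (\<open>cometric_module_of_separated_cocomplete\<close>).\<close>

section \<open>Truncated difference\<close>

lemma ennreal_eqI_le:
  fixes a b :: ennreal
  assumes "\<And>r. a \<le> r \<longleftrightarrow> b \<le> r"
  shows "a = b"
  using assms by (meson order_antisym order_refl)

lemma monus_max_left: "max a b -\<^sub>+ r = max (a -\<^sub>+ r) (b -\<^sub>+ r)"
  by (rule ennreal_eqI_le) (simp add: monus_le_iff)

lemma monus_min_right: "m -\<^sub>+ min r s = max (m -\<^sub>+ r) (m -\<^sub>+ s)"
  by (rule ennreal_eqI_le) (simp add: monus_le_iff ennreal_min_add)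

lemma monus_add_right: "m -\<^sub>+ (r + s) = (m -\<^sub>+ s) -\<^sub>+ r"
  by (rule ennreal_eqI_le) (simp add: monus_le_iff ac_simps)

lemma zero_monus: "0 -\<^sub>+ r = 0"
  by (simp add: monus_def)

lemma monus_zero: "m -\<^sub>+ 0 = m"
  by (simp add: monus_def)

lemma monus_top: "m -\<^sub>+ \<infinity> = 0"
  by (simp add: monus_def)

section \<open>The Isbell adjunction\<close>

lemma sup_dist_le_iff: "sup_dist X f f' \<le> r \<longleftrightarrow> (\<forall>x\<in>X. f' x \<le> f x + r)"
  by (simp add: sup_dist_def SUP_le_iff monus_le_iff)

lemma isbell_L_le_iff:
  assumes "y \<in> X"
  shows "isbell_L X d f y \<le> s \<longleftrightarrow> (\<forall>x\<in>X. d x y \<le> f x + s)"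
  using assms by (simp add: isbell_L_def SUP_le_iff monus_le_iff)

lemma isbell_R_le_iff:
  assumes "x \<in> X"
  shows "isbell_R X d g x \<le> s \<longleftrightarrow> (\<forall>y\<in>X. d x y \<le> g y + s)"
  using assms by (simp add: isbell_R_def SUP_le_iff monus_le_iff)

text \<open>With the quantitative slack \<open>r\<close> the adjunction compares distances as well as the pointwise
  order; \<open>r = 0\<close> is the order-theoretic Galois connection.\<close>

lemma isbell_adjunction:
  "(\<forall>y\<in>X. isbell_L X d f y \<le> g y + r) \<longleftrightarrow> (\<forall>x\<in>X. isbell_R X d g x \<le> f x + r)"
  by (auto simp: isbell_L_le_iff isbell_R_le_iff ac_simps)

lemma isbell_R_L_le:
  assumes "x \<in> X"
  shows "isbell_R X d (isbell_L X d f) x \<le> f x"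
  using isbell_adjunction[of X d f "isbell_L X d f" 0] assms by simp

lemma isbell_L_R_le:
  assumes "y \<in> X"
  shows "isbell_L X d (isbell_R X d g) y \<le> g y"
  using isbell_adjunction[of X d "isbell_R X d g" g 0] assms by simp

lemma isbell_L_antimono:
  assumes "\<And>x. x \<in> X \<Longrightarrow> f x \<le> f' x" and "y \<in> X"
  shows "isbell_L X d f' y \<le> isbell_L X d f y"
proof -
  have "d x y \<le> f x + isbell_L X d f y" if "x \<in> X" for x
    using isbell_L_le_iff[OF \<open>y \<in> X\<close>] that by blast
  then show ?thesis
    unfolding isbell_L_le_iff[OF \<open>y \<in> X\<close>]
    using assms(1) by (meson add_right_mono order_trans)
qed

lemma isbell_L_R_L: "isbell_L X d (isbell_R X d (isbell_L X d f)) = isbell_L X d f"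
proof (rule extensionalityI[of _ X])
  fix y assume "y \<in> X"
  then show "isbell_L X d (isbell_R X d (isbell_L X d f)) y = isbell_L X d f y"
    by (intro order_antisym isbell_L_R_le isbell_L_antimono isbell_R_L_le)
qed (simp_all add: isbell_L_def)

section \<open>Points of the Isbell completion\<close>

lemma isbell_L_copresheaf:
  assumes "generalized_metric_space X d"
  shows "isbell_L X d f \<in> copresheaves X d"
proof -
  interpret generalized_metric_space X d by fact
  have "isbell_L X d f y' \<le> isbell_L X d f y + d y y'" if "y \<in> X" "y' \<in> X" for y y'
    unfolding isbell_L_le_iff[OF that(2)]
  proof
    fix x assume x: "x \<in> X"
    then have "d x y \<le> f x + isbell_L X d f y"
      using isbell_L_le_iff[OF that(1)] by blast
    then show "d x y' \<le> f x + (isbell_L X d f y + d y y')"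
      using triangle[OF x that] by (metis add.assoc add_right_mono order_trans)
  qed
  then show ?thesis
    by (auto simp: copresheaves_def short_map_def ennreal_gdist_def monus_le_iff isbell_L_def)
qed

lemma isbell_R_presheaf:
  assumes "generalized_metric_space X d"
  shows "isbell_R X d g \<in> presheaves X d"
proof -
  interpret generalized_metric_space X d by fact
  have "isbell_R X d g x' \<le> isbell_R X d g x + d x' x" if "x \<in> X" "x' \<in> X" for x x'
    unfolding isbell_R_le_iff[OF that(2)]
  proof
    fix y assume y: "y \<in> X"
    then have "d x y \<le> g y + isbell_R X d g x"
      using isbell_R_le_iff[OF that(1)] by blast
    then have "d x' x + d x y \<le> d x' x + (g y + isbell_R X d g x)"
      by (rule add_left_mono)
    then show "d x' y \<le> g y + (isbell_R X d g x + d x' x)"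
      using order_trans[OF triangle[OF that(2) that(1) y]] by (simp add: ac_simps)
  qed
  then show ?thesis
    by (auto simp: presheaves_def short_map_def op_dist_def ennreal_gdist_def monus_le_iff
        isbell_R_def)
qed

lemma isbell_hull_in_completion:
  assumes "generalized_metric_space X d"
  shows "(isbell_R X d (isbell_L X d f), isbell_L X d f) \<in> isbell_completion X d"
  by (simp add: isbell_completion_def isbell_L_copresheaf isbell_R_presheaf isbell_L_R_L assms)

text \<open>The two components of the metric agree: for \<open>p = (f, g)\<close> and \<open>q = (f', g')\<close>, the inequality
  \<open>f' \<le> f + r\<close> reads \<open>R g' \<le> f + r\<close>, which by adjunction is \<open>L f \<le> g' + r\<close>, that is,
  \<open>g \<le> g' + r\<close>.\<close>

lemma isbell_dist_le_iff_snd: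
  assumes "p \<in> isbell_completion X d" and "q \<in> isbell_completion X d"
  shows "isbell_dist X p q \<le> r \<longleftrightarrow> (\<forall>y\<in>X. snd p y \<le> snd q y + r)"
proof -
  have "isbell_L X d (fst p) = snd p" "isbell_R X d (snd q) = fst q"
    using assms by (auto simp: isbell_completion_def)
  then have "(\<forall>x\<in>X. fst q x \<le> fst p x + r) \<longleftrightarrow> (\<forall>y\<in>X. snd p y \<le> snd q y + r)"
    using isbell_adjunction[of X d "fst p" "snd q" r] by simp
  then show ?thesis
    by (simp add: isbell_dist_def op_dist_def sup_dist_le_iff)
qed

lemma isbell_dist_separated:
  assumes p: "p \<in> isbell_completion X d" and q: "q \<in> isbell_completion X d"
    and "isbell_dist X p q = 0" and "isbell_dist X q p = 0"
  shows "p = q"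
proof -
  have "\<forall>y\<in>X. snd p y = snd q y"
    using isbell_dist_le_iff_snd[OF p q, of 0] isbell_dist_le_iff_snd[OF q p, of 0] assms(3,4)
    by (auto intro: order_antisym)
  moreover have "snd p \<in> extensional X" "snd q \<in> extensional X"
    using p q by (auto simp: isbell_completion_def copresheaves_def)
  ultimately have "snd p = snd q"
    by (auto intro: extensionalityI)
  moreover have "fst p = isbell_R X d (snd p)" "fst q = isbell_R X d (snd q)"
    using p q by (auto simp: isbell_completion_def)
  ultimately show ?thesis
    by (simp add: prod_eq_iff)
qed

section \<open>Weighted colimits in the Isbell completion\<close>

text \<open>The candidate is the hull of the colimit of the presheaf components, \<open>inf\<^sub>e (f\<^sub>e + w\<^sub>e)\<close>. Its
  universal property can be tested on co-presheaf components, where \<open>L (inf\<^sub>e (f\<^sub>e + w\<^sub>e)) \<le> s\<close>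
  unfolds to \<open>g\<^sub>e \<le> w\<^sub>e + s\<close> for every \<open>e\<close>.\<close>

lemma isbell_weighted_colimit:
  fixes W :: "'d \<Rightarrow> ennreal"
  assumes X: "generalized_metric_space X d"
    and J: "\<And>e. e \<in> D \<Longrightarrow> J e \<in> isbell_completion X d"
  defines "h \<equiv> \<lambda>x. INF e\<in>D. fst (J e) x + W e"
  shows "is_weighted_colimit D (isbell_completion X d) (isbell_dist X) J W
           (isbell_R X d (isbell_L X d h), isbell_L X d h)"
    (is "is_weighted_colimit _ _ _ _ _ ?c")
  unfolding is_weighted_colimit_def
proof (intro conjI ballI)
  show c: "?c \<in> isbell_completion X d"
    by (rule isbell_hull_in_completion[OF X])
  fix z assume z: "z \<in> isbell_completion X d"
  have L: "isbell_L X d (fst (J e)) = snd (J e)" if "e \<in> D" for e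
    using J[OF that] by (auto simp: isbell_completion_def)
  have h_le: "isbell_L X d h y \<le> s \<longleftrightarrow> (\<forall>e\<in>D. snd (J e) y \<le> W e + s)"
    if y: "y \<in> X" for y s
  proof -
    \<comment> \<open>With \<open>s\<close> on the left, the infimum stands alone on the right of the inequality, where
      being a lower bound can be tested on each \<open>e\<close> separately.\<close>
    have move: "d x y \<le> a + b \<longleftrightarrow> d x y -\<^sub>+ b \<le> a" for x a b
      by (simp add: monus_le_iff add.commute)
    have "isbell_L X d h y \<le> s \<longleftrightarrow> (\<forall>x\<in>X. d x y -\<^sub>+ s \<le> h x)"
      using y by (simp add: isbell_L_le_iff move)
    also have "\<dots> \<longleftrightarrow> (\<forall>e\<in>D. \<forall>x\<in>X. d x y \<le> fst (J e) x + (W e + s))"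
      unfolding h_def by (auto simp: le_INF_iff monus_le_iff ac_simps)
    also have "\<dots> \<longleftrightarrow> (\<forall>e\<in>D. isbell_L X d (fst (J e)) y \<le> W e + s)"
      using isbell_L_le_iff[OF y] by metis
    finally show ?thesis
      by (simp add: L)
  qed
  show "isbell_dist X ?c z = (SUP e\<in>D. isbell_dist X (J e) z -\<^sub>+ W e)"
  proof (rule ennreal_eqI_le)
    fix r
    have "isbell_dist X ?c z \<le> r \<longleftrightarrow> (\<forall>y\<in>X. \<forall>e\<in>D. snd (J e) y \<le> W e + (snd z y + r))"
      by (simp add: isbell_dist_le_iff_snd[OF c z] h_le)
    also have "\<dots> \<longleftrightarrow> (\<forall>e\<in>D. \<forall>y\<in>X. snd (J e) y \<le> snd z y + (W e + r))"
      by (auto simp: ac_simps)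
    also have "\<dots> \<longleftrightarrow> (\<forall>e\<in>D. isbell_dist X (J e) z \<le> W e + r)"
      by (simp add: isbell_dist_le_iff_snd[OF J z])
    also have "\<dots> \<longleftrightarrow> (SUP e\<in>D. isbell_dist X (J e) z -\<^sub>+ W e) \<le> r"
      by (simp add: SUP_le_iff monus_le_iff)
    finally show "isbell_dist X ?c z \<le> r \<longleftrightarrow> (SUP e\<in>D. isbell_dist X (J e) z -\<^sub>+ W e) \<le> r" .
  qed
qed

lemma isbell_cocomplete:
  assumes "generalized_metric_space X d"
  shows "cocomplete TYPE('d) (isbell_completion X d) (isbell_dist X)"
  unfolding cocomplete_def
proof (intro conjI allI impI)
  show "generalized_metric_space (isbell_completion X d) (isbell_dist X)"
    by (rule generalized_metric_space_isbell)
  fix D :: "'d set" and dD J W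
  assume "short_map D dD (isbell_completion X d) (isbell_dist X) J"
  then have J: "J e \<in> isbell_completion X d" if "e \<in> D" for e
    using that by (auto simp: short_map_def)
  show "\<exists>c. is_weighted_colimit D (isbell_completion X d) (isbell_dist X) J W c"
    by (rule exI, rule isbell_weighted_colimit[OF assms J])
qed

section \<open>Co-metric modules from cocompleteness\<close>

text \<open>The module laws are equations between points, and by separatedness it is enough to check
  them after applying \<open>d(-, z)\<close>, where they become laws of truncated subtraction and
  maximum.\<close>

lemma cometric_module_of_operations:
  fixes Z :: "'z set" and d :: "'z \<Rightarrow> 'z \<Rightarrow> ennreal"
    and join :: "'z \<Rightarrow> 'z \<Rightarrow> 'z" and bottom :: 'z and act :: "ennreal \<Rightarrow> 'z \<Rightarrow> 'z"
  assumes Z: "generalized_metric_space Z d"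
    and separated: "\<And>p q. \<lbrakk>p \<in> Z; q \<in> Z; d p q = 0; d q p = 0\<rbrakk> \<Longrightarrow> p = q"
    and join_closed: "\<And>p q. \<lbrakk>p \<in> Z; q \<in> Z\<rbrakk> \<Longrightarrow> join p q \<in> Z"
    and join_dist: "\<And>p q z. \<lbrakk>p \<in> Z; q \<in> Z; z \<in> Z\<rbrakk> \<Longrightarrow> d (join p q) z = max (d p z) (d q z)"
    and bottom_closed: "bottom \<in> Z"
    and bottom_dist: "\<And>z. z \<in> Z \<Longrightarrow> d bottom z = 0"
    and act_closed: "\<And>r p. p \<in> Z \<Longrightarrow> act r p \<in> Z"
    and act_dist: "\<And>r p z. \<lbrakk>p \<in> Z; z \<in> Z\<rbrakk> \<Longrightarrow> d (act r p) z = d p z -\<^sub>+ r"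
  shows "cometric_semitropical_module \<lparr>carrier = Z, mult = join, one = bottom\<rparr> act d"
    (is "cometric_semitropical_module ?M act d")
proof -
  interpret generalized_metric_space Z d by fact
  have eqI: "p = q" if "p \<in> Z" "q \<in> Z" "\<And>z. z \<in> Z \<Longrightarrow> d p z = d q z" for p q
    using that(3)[of q] that(3)[of p] that(1,2) by (intro separated) (simp_all add: dist_self)
  note closed = join_closed bottom_closed act_closed
  note dists = join_dist bottom_dist act_dist
  have monoid: "comm_monoid ?M"
    by (rule comm_monoidI) (auto intro!: eqI simp: closed dists ac_simps)
  have act_join: "act r (join p q) = join (act r p) (act r q)" if "p \<in> Z" "q \<in> Z" for r p q
    using that by (auto intro!: eqI simp: closed dists monus_max_left)
  have act_bottom: "act r bottom = bottom" for r
    by (auto intro!: eqI simp: closed dists zero_monus)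
  have act_min: "act (min r s) p = join (act r p) (act s p)" if "p \<in> Z" for r s p
    using that by (auto intro!: eqI simp: closed dists monus_min_right)
  have act_add: "act (r + s) p = act r (act s p)" if "p \<in> Z" for r s p
    using that by (auto intro!: eqI simp: closed dists monus_add_right)
  have act_zero: "act 0 p = p" if "p \<in> Z" for p
    using that by (auto intro!: eqI simp: closed dists monus_zero)
  have act_top: "act \<infinity> p = bottom" if "p \<in> Z" for p
    using that by (intro eqI) (simp_all add: closed dists monus_top del: infinity_ennreal_def)
  have "(\<lambda>r. restrict (act r) (carrier ?M)) \<in> semiring_maps semitropical (End_semiring ?M)"
    using act_top
    by (simp add: semiring_maps_def ring_hom_def semitropical_def End_semiring_def
        monoid_maps_def hom_def compose_def fun_eq_iff Pi_iff closed act_join act_bottom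
        act_min act_add act_zero)
  moreover have "(\<lambda>m. d m x) \<in> semitropical_module_maps ?M act max_monoid max_act"
    if "x \<in> carrier ?M" for x
    using that
    by (simp add: semitropical_module_maps_def monoid_maps_def hom_def max_monoid_def
        max_act_def dists)
  ultimately show ?thesis
    using Z monoid
    by (simp add: cometric_semitropical_module_def cometric_semitropical_module_axioms_def
        semitropical_module_def semitropical_module_axioms_def)
qed

text \<open>On a discrete indexing space, with all distances between distinct points infinite, every
  diagram and every weight is short, so any weighted family of points has a colimit.\<close>

lemma cocomplete_discrete_colimit:
  fixes D :: "'d set"
  assumes "cocomplete TYPE('d) Z dZ" and J: "J \<in> D \<rightarrow> Z"
  obtains c where "is_weighted_colimit D Z dZ J W c"
proof -
  interpret generalized_metric_space Z dZ
    using assms(1) by (simp add: cocomplete_def)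
  define \<delta> :: "'d \<Rightarrow> 'd \<Rightarrow> ennreal" where "\<delta> = (\<lambda>e e'. if e = e' then 0 else \<infinity>)"
  have "generalized_metric_space D \<delta>"
    by unfold_locales (auto simp: \<delta>_def)
  moreover have "short_map D \<delta> Z dZ J"
    using J by (auto simp: short_map_def \<delta>_def dist_self Pi_iff)
  moreover have "short_map D (op_dist \<delta>) UNIV ennreal_gdist W"
    by (auto simp: short_map_def op_dist_def \<delta>_def ennreal_gdist_def monus_def)
  ultimately show ?thesis
    using assms(1) that unfolding cocomplete_def by blast
qed

text \<open>All three operations are colimits over subsets of a two-point space, which is why
  cocompleteness for indexing spaces of booleans is enough.\<close>

lemma cometric_module_of_separated_cocomplete:
  fixes Z :: "'z set"
  assumes cocomplete: "cocomplete TYPE(bool) Z d"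
    and separated: "\<And>p q. \<lbrakk>p \<in> Z; q \<in> Z; d p q = 0; d q p = 0\<rbrakk> \<Longrightarrow> p = q"
  shows "\<exists>M act. carrier (M :: 'z monoid) = Z \<and> cometric_semitropical_module M act d"
proof -
  have Z: "generalized_metric_space Z d"
    using cocomplete by (simp add: cocomplete_def)
  define colim where "colim D J W = (SOME c. is_weighted_colimit D Z d J W c)"
    for D :: "bool set" and J W
  have colim: "is_weighted_colimit D Z d J W (colim D J W)" if "J \<in> D \<rightarrow> Z" for D J W
  proof -
    obtain c where "is_weighted_colimit D Z d J W c"
      by (rule cocomplete_discrete_colimit[OF cocomplete \<open>J \<in> D \<rightarrow> Z\<close>])
    then show ?thesis
      unfolding colim_def by (rule someI)
  qed
  define bottom where "bottom = colim {} undefined undefined"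
  have bottom: "is_weighted_colimit ({} :: bool set) Z d undefined undefined bottom"
    unfolding bottom_def by (rule colim) simp
  define join where "join p q = colim UNIV (\<lambda>b. if b then p else q) (\<lambda>_. 0)" for p q
  have join: "is_weighted_colimit UNIV Z d (\<lambda>b. if b then p else q) (\<lambda>_. 0) (join p q)"
    if "p \<in> Z" "q \<in> Z" for p q
    unfolding join_def using that by (intro colim) simp
  define act where "act r p = colim {True} (\<lambda>_. p) (\<lambda>_. r)" for r p
  have act: "is_weighted_colimit {True} Z d (\<lambda>_. p) (\<lambda>_. r) (act r p)" if "p \<in> Z" for r p
    unfolding act_def using that by (intro colim) simp
  have "cometric_semitropical_module \<lparr>carrier = Z, mult = join, one = bottom\<rparr> act d"
  proof (rule cometric_module_of_operations[OF Z separated])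
    fix p q z assume pq: "p \<in> Z" "q \<in> Z"
    show "join p q \<in> Z"
      using join[OF pq] by (simp add: is_weighted_colimit_def)
    show "d (join p q) z = max (d p z) (d q z)" if "z \<in> Z"
      using join[OF pq] that
      by (simp add: is_weighted_colimit_def UNIV_bool monus_zero sup_max max.commute)
  next
    show "bottom \<in> Z"
      using bottom by (simp add: is_weighted_colimit_def)
    show "d bottom z = 0" if "z \<in> Z" for z
      using bottom that by (simp add: is_weighted_colimit_def bot_ennreal)
  next
    fix r p z assume p: "p \<in> Z"
    show "act r p \<in> Z"
      using act[OF p] by (simp add: is_weighted_colimit_def)
    show "d (act r p) z = d p z -\<^sub>+ r" if "z \<in> Z"
      using act[OF p] that by (simp add: is_weighted_colimit_def)
  qed
  then show ?thesis
    by (intro exI conjI) simp_all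
qed

theorem corollary17:
  fixes X :: "'a set" and d :: "'a \<Rightarrow> 'a \<Rightarrow> ennreal"
  assumes "generalized_metric_space X d"
  shows "cocomplete TYPE('d) (isbell_completion X d) (isbell_dist X) \<and>
    (\<exists>M act. carrier (M :: (('a \<Rightarrow> ennreal) \<times> ('a \<Rightarrow> ennreal)) monoid) = isbell_completion X d \<and>
       cometric_semitropical_module M act (isbell_dist X))"
proof
  show "cocomplete TYPE('d) (isbell_completion X d) (isbell_dist X)"
    by (rule isbell_cocomplete[OF assms])
  show "\<exists>M act. carrier (M :: (('a \<Rightarrow> ennreal) \<times> ('a \<Rightarrow> ennreal)) monoid) = isbell_completion X d \<and>
      cometric_semitropical_module M act (isbell_dist X)"
    by (rule cometric_module_of_separated_cocomplete[OF isbell_cocomplete[OF assms]])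
      (rule isbell_dist_separated)
qed

end
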